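(* Let $X\subseteq\mathbb{R}^m$ and $Y\subseteq\mathbb{R}^n$ be nonempty, compact and convex, and let $\mathcal{Q}(x)=\inf\{f(y,x):y\in Y\}$ for $x\in X$, where $f$ is convex and differentiable on $Y\times X$. Let $\bar x\in X$, $\varepsilon_1,\varepsilon_2\ge0$, and let $\hat y=\hat y(\varepsilon_1)\in Y$ be an $\varepsilon_1$-optimal solution of $\inf\{f(y,\bar x):y\in Y\}$, i.e. $\mathcal{Q}(\bar x)\ge f(\hat y,\bar x)-\varepsilon_1$. Let also $\tilde y\in Y$ be an $\varepsilon_2$-optimal solution of the problem $\max_{y\in Y}\langle\nabla_yf(\hat y,\bar x),\hat y-y\rangle$ with optimal value $\ell_1(\hat y,\bar x)$, i.e. $\ell_1(\hat y,\bar x)-\varepsilon_2\le\langle\nabla_yf(\hat y,\bar x),\hat y-\tilde y\rangle$. Set $$\eta(\varepsilon_1,\varepsilon_2)=\varepsilon_2-\langle\tilde y-\hat y,\nabla_yf(\hat y,\bar x)\rangle,\qquad\hat\ell_1=\langle\hat y-\tilde y,\nabla_yf(\hat y,\bar x)\rangle .$$ Then the affine function $$\mathcal{C}(x):=f(\hat y,\bar x)-\eta(\varepsilon_1,\varepsilon_2)+\langle\nabla_xf(\hat y,\bar x),x-\bar x\rangle$$ is a cut for $\mathcal{Q}$ at $\bar x$, i.e. $\mathcal{Q}(x)\ge\mathcal{C}(x)$ for every $x\in X$, and the distance $\mathcal{Q}(\bar x)-\mathcal{C}(\bar x)$ is at most $\varepsilon_2+\hat\ell_1$. Moreover, if there exists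 $M_1>0$ such that $\|\nabla_yf(y_2,x)-\nabla_yf(y_1,x)\|\le M_1\|y_2-y_1\|$ for every $x\in X$, $y_1,y_2\in Y$, then, setting $$\varepsilon_0=\begin{cases}\varepsilon_2+\hat\ell_1&\text{if }\hat\ell_1\le0,\\ \varepsilon_2+\dfrac{\hat\ell_1}{2M_1\mathrm{Diam}(Y)^2}\big(2M_1\mathrm{Diam}(Y)^2-\hat\ell_1\big)&\text{if }0<\hat\ell_1\le M_1\mathrm{Diam}(Y)^2,\\ \varepsilon_2+\frac12\hat\ell_1&\text{otherwise,}\end{cases}$$ the distance $\mathcal{Q}(\bar x)-\mathcal{C}(\bar x)$ is at most $\varepsilon_0$.
   Context: A cut for $\mathcal{Q}$ is an affine function $\mathcal{C}$ with $\mathcal{Q}(x)\ge\mathcal{C}(x)$ for all $x\in X$. $\mathrm{Diam}(Y)=\max_{x,y\in Y}\|x-y\|$ (Euclidean norm). $\nabla_yf,\nabla_xf$ denote partial gradients of $f(y,x)$. *)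

theory Defs
  imports "HOL-Analysis.Analysis"
begin

text \<open>
  A version of \<open>GDERIV\<close> relative to a set. If \<open>S\<close> has empty interior, \<open>g\<close> need not be unique.
\<close>
definition has_gradient_within ::
    "('a::real_inner \<Rightarrow> real) \<Rightarrow> 'a \<Rightarrow> 'a \<Rightarrow> 'a set \<Rightarrow> bool"
  where "has_gradient_within f g x S \<longleftrightarrow> (f has_derivative (\<lambda>h. h \<bullet> g)) (at x within S)"

text \<open>
  The infimum is taken in the conditionally complete type \<open>real\<close>, so this is the true infimum
  only when \<open>Y\<close> is nonempty and \<open>\<lambda>y. f (y, x)\<close> is bounded below on \<open>Y\<close>.
\<close>
definition value_function :: "('b \<times> 'a \<Rightarrow> real) \<Rightarrow> 'b set \<Rightarrow> 'a \<Rightarrow> real"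
  where "value_function f Y x = (INF y\<in>Y. f (y, x))"

definition is_cut :: "'a::real_vector set \<Rightarrow> ('a \<Rightarrow> real) \<Rightarrow> ('a \<Rightarrow> real) \<Rightarrow> bool"
  where "is_cut X Q C \<longleftrightarrow>
    (\<exists>L b. linear L \<and> (\<forall>x. C x = L x + b)) \<and> (\<forall>x\<in>X. Q x \<ge> C x)"

text \<open>In \<open>cut_gap_bound\<close>, \<open>D\<close> stands for the diameter of the feasible set \<open>Y\<close>.\<close>
definition cut_gap_bound :: "real \<Rightarrow> real \<Rightarrow> real \<Rightarrow> real \<Rightarrow> real"
  where "cut_gap_bound \<epsilon>2 l M D =
    (if l \<le> 0 then \<epsilon>2 + l
     else if l \<le> M * D\<^sup>2 then \<epsilon>2 + l / (2 * M * D\<^sup>2) * (2 * M * D\<^sup>2 - l)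
     else \<epsilon>2 + 1/2 * l)"

end

theory Submission
  imports Defs
begin

text \<open>
  The slope of the cut comes from the tangent inequality of the jointly convex function \<open>f\<close> at
  \<open>(yhat, xbar)\<close>: writing \<open>gy\<close> and \<open>gx\<close> for the two partial gradients there,
  \<open>f (y, x) \<ge> f (yhat, xbar) + gy \<bullet> (y - yhat) + gx \<bullet> (x - xbar)\<close>.
  The term linear in \<open>y\<close> is at least \<open>- l1\<close> on \<open>Y\<close>, and \<open>l1 \<le> \<epsilon>2 + lhat = \<eta>\<close>; taking the infimum over
  \<open>y\<close> gives the cut. Since \<open>Q xbar \<le> f (yhat, xbar)\<close>, the gap at \<open>xbar\<close> is at most \<open>\<eta>\<close>.

  The sets may have empty interior, so gradients relative to them need not be unique. They are only
  ever paired with directions between points of the set, and there their value is determined: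
  it is the derivative of \<open>f\<close> along the segment, relative to \<open>{0..1}\<close>, which is unique. This is what
  allows the total derivative of \<open>f\<close> to be split into the two given partial gradients
  (\<open>derivative_eq_sum_of_partial_gradients\<close>).

  If the gradient in \<open>y\<close> is Lipschitz, \<open>Q xbar\<close> can be bounded further by moving from \<open>yhat\<close>
  towards \<open>ytilde\<close>: with \<open>d\<close> the diameter of \<open>Y\<close>, the objective at
  \<open>yhat + t *\<^sub>R (ytilde - yhat)\<close> is at most \<open>f (yhat, xbar) - t * lhat + M / 2 * (t * d)\<^sup>2\<close> for
  \<open>t \<in> {0..1}\<close> (\<open>lipschitz_gradient_descent\<close>), and \<open>Q xbar\<close> is at most each of these values. The
  three cases of \<open>cut_gap_bound\<close> are governed by where in \<open>{0..1}\<close> this parabola is smallest: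
  at \<open>t = 0\<close>, at its vertex, or at \<open>t = 1\<close>.
\<close>

text \<open>
  Restricting to a segment replaces derivatives relative to an arbitrary convex set by
  derivatives relative to \<open>{0..1}\<close>, which are unique.
\<close>
lemma has_vector_derivative_along_segment:
  fixes f :: "'a::real_normed_vector \<Rightarrow> real"
  assumes S: "convex S" "a \<in> S" "b \<in> S" and t: "t \<in> {0..1}"
    and f: "(f has_derivative D) (at (a + t *\<^sub>R (b - a)) within S)"
  shows "((\<lambda>s. f (a + s *\<^sub>R (b - a))) has_vector_derivative D (b - a)) (at t within {0..1})"
proof -
  have sub: "(\<lambda>s. a + s *\<^sub>R (b - a)) ` {0..1} \<subseteq> S"
    using S by (auto intro: convexD_alt simp: algebra_simps convex_alt)
  have "((\<lambda>s. a + s *\<^sub>R (b - a)) has_derivative (\<lambda>h. h *\<^sub>R (b - a))) (at t within {0..1})"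
    by (auto intro!: derivative_eq_intros)
  from has_derivative_in_compose[OF this has_derivative_subset[OF f sub]]
  have "((\<lambda>s. f (a + s *\<^sub>R (b - a))) has_derivative (\<lambda>h. D (h *\<^sub>R (b - a)))) (at t within {0..1})" .
  moreover have "linear D"
    using f has_derivative_linear by blast
  ultimately show ?thesis
    by (simp add: has_vector_derivative_def linear_scale)
qed

text \<open>
  By convexity the difference quotients of \<open>f\<close> along the segment from \<open>a\<close> to \<open>b\<close> are at most
  \<open>f b - f a\<close>, hence so is their limit.
\<close>
lemma convex_on_imp_above_tangent_within:
  fixes f :: "'a::real_normed_vector \<Rightarrow> real"
  assumes f: "convex_on S f" and ab: "a \<in> S" "b \<in> S"
    and D: "(f has_derivative D) (at a within S)"
  shows "f a + D (b - a) \<le> f b"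
proof -
  let ?q = "\<lambda>s. (f (a + s *\<^sub>R (b - a)) - f a) / s"
  have "convex S" using f by (rule convex_on_imp_convex)
  then have "((\<lambda>s. f (a + s *\<^sub>R (b - a))) has_vector_derivative D (b - a)) (at 0 within {0..1})"
    using has_vector_derivative_along_segment[of S a b 0 f D] ab D by simp
  then have lim: "(?q \<longlongrightarrow> D (b - a)) (at 0 within {0..1})"
    by (simp add: has_real_derivative_iff_has_vector_derivative[symmetric]
        has_field_derivative_iff)
  have "?q s \<le> f b - f a" if s: "0 < s" "s \<le> 1" for s
  proof -
    have "f ((1 - s) *\<^sub>R a + s *\<^sub>R b) \<le> (1 - s) * f a + s * f b"
      using convex_onD[OF f, of s a b] ab s by simp
    then have "f (a + s *\<^sub>R (b - a)) - f a \<le> (f b - f a) * s"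
      by (simp add: algebra_simps)
    then show ?thesis using s by (simp add: pos_divide_le_eq)
  qed
  then have "eventually (\<lambda>s. ?q s \<le> f b - f a) (at 0 within {0..1})"
    by (auto simp: eventually_at intro!: exI[of _ 1])
  then have "D (b - a) \<le> f b - f a"
    by (rule tendsto_upperbound[OF lim]) (simp add: at_within_Icc_at_right)
  then show ?thesis by simp
qed

text \<open>
  The inner products on the right do not depend on the choice of the partial gradients, because
  they are derivatives along the two segments that change one argument only.
\<close>
lemma derivative_eq_sum_of_partial_gradients:
  fixes f :: "'b::real_inner \<times> 'a::real_inner \<Rightarrow> real"
  assumes Y: "convex Y" "y0 \<in> Y" "y \<in> Y" and X: "convex X" "x0 \<in> X" "x \<in> X"
    and D: "(f has_derivative D) (at (y0, x0) within Y \<times> X)"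
    and gy: "has_gradient_within (\<lambda>y'. f (y', x0)) gy y0 Y"
    and gx: "has_gradient_within (\<lambda>x'. f (y0, x')) gx x0 X"
  shows "D (y - y0, x - x0) = gy \<bullet> (y - y0) + gx \<bullet> (x - x0)"
proof -
  have YX: "convex (Y \<times> X)" using Y X by (simp add: convex_Times)
  have nontriv: "at 0 within {0..1::real} \<noteq> bot"
    by (simp add: at_within_Icc_at_right)
  have "D (y - y0, 0) = (y - y0) \<bullet> gy"
  proof (rule vector_derivative_unique_within[OF nontriv])
    show "((\<lambda>s. f (y0 + s *\<^sub>R (y - y0), x0)) has_vector_derivative D (y - y0, 0))
        (at 0 within {0..1})"
      using has_vector_derivative_along_segment[OF YX, of "(y0, x0)" "(y, x0)" 0 f D] Y X D
      by simp
    show "((\<lambda>s. f (y0 + s *\<^sub>R (y - y0), x0)) has_vector_derivative (y - y0) \<bullet> gy)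
        (at 0 within {0..1})"
      using has_vector_derivative_along_segment[OF Y, of 0 "\<lambda>y'. f (y', x0)"] gy
      by (simp add: has_gradient_within_def)
  qed
  moreover have "D (0, x - x0) = (x - x0) \<bullet> gx"
  proof (rule vector_derivative_unique_within[OF nontriv])
    show "((\<lambda>s. f (y0, x0 + s *\<^sub>R (x - x0))) has_vector_derivative D (0, x - x0))
        (at 0 within {0..1})"
      using has_vector_derivative_along_segment[OF YX, of "(y0, x0)" "(y0, x)" 0 f D] Y X D
      by simp
    show "((\<lambda>s. f (y0, x0 + s *\<^sub>R (x - x0))) has_vector_derivative (x - x0) \<bullet> gx)
        (at 0 within {0..1})"
      using has_vector_derivative_along_segment[OF X, of 0 "\<lambda>x'. f (y0, x')"] gx
      by (simp add: has_gradient_within_def)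
  qed
  moreover have "D (y - y0, x - x0) = D (y - y0, 0) + D (0, x - x0)"
    using linear_add[OF has_derivative_linear[OF D], of "(y - y0, 0)" "(0, x - x0)"] by simp
  ultimately show ?thesis by (simp add: inner_commute)
qed

text \<open>
  The difference between the two sides, as a function of \<open>t\<close>, vanishes at \<open>0\<close>, and its derivative
  \<open>(g (a + t *\<^sub>R (b - a)) - g a) \<bullet> (b - a) - M * t * (norm (b - a))\<^sup>2\<close> is nonpositive by the
  Cauchy-Schwarz inequality and the Lipschitz bound.
\<close>
lemma lipschitz_gradient_descent:
  fixes f :: "'a::real_inner \<Rightarrow> real"
  assumes S: "convex S" "a \<in> S" "b \<in> S"
    and g: "\<And>y. y \<in> S \<Longrightarrow> has_gradient_within f (g y) y S"
    and lip: "\<And>y. y \<in> S \<Longrightarrow> norm (g y - g a) \<le> M * norm (y - a)"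
    and t: "t \<in> {0..1}"
  shows "f (a + t *\<^sub>R (b - a)) \<le> f a + t * (g a \<bullet> (b - a)) + M / 2 * (t * norm (b - a))\<^sup>2"
proof -
  let ?p = "\<lambda>s. a + s *\<^sub>R (b - a)"
  define h where
    "h s = f (?p s) - s * (g a \<bullet> (b - a)) - M / 2 * (s * norm (b - a))\<^sup>2" for s
  define h' where
    "h' s = (b - a) \<bullet> g (?p s) - g a \<bullet> (b - a) - M * s * (norm (b - a))\<^sup>2" for s
  have mem: "?p s \<in> S" if "s \<in> {0..1}" for s
    using S that by (auto simp: algebra_simps convex_alt)
  have h: "(h has_real_derivative h' s) (at s within {0..1})" if s: "s \<in> {0..1}" for s
  proof -
    have "((\<lambda>s. f (?p s)) has_real_derivative (b - a) \<bullet> g (?p s)) (at s within {0..1})"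
      using has_vector_derivative_along_segment[OF S s, of f] g[OF mem[OF s]]
      by (simp add: has_gradient_within_def has_real_derivative_iff_has_vector_derivative)
    then show ?thesis
      unfolding h_def h'_def
      by (auto intro!: derivative_eq_intros simp: power2_eq_square)
  qed
  have h'_nonpos: "h' s \<le> 0" if s: "s \<in> {0..1}" for s
  proof -
    have "(b - a) \<bullet> g (?p s) - g a \<bullet> (b - a) = (g (?p s) - g a) \<bullet> (b - a)"
      by (simp add: inner_diff inner_commute)
    also have "\<dots> \<le> norm (g (?p s) - g a) * norm (b - a)"
      by (rule norm_cauchy_schwarz)
    also have "\<dots> \<le> M * norm (?p s - a) * norm (b - a)"
      by (intro mult_right_mono lip mem s) simp
    also have "\<dots> = M * s * (norm (b - a))\<^sup>2"
      using s by (simp add: power2_eq_square)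
    finally show ?thesis by (simp add: h'_def)
  qed
  have "h t \<le> h 0"
  proof -
    have "(h has_derivative (\<lambda>x. h' s * x)) (at s within {0..t})" if "0 \<le> s" "s \<le> t" for s
      using h[of s] that t
      by (auto simp: has_field_derivative_def intro: has_derivative_subset)
    then obtain s where s: "s \<in> {0..t}" "h t - h 0 = h' s * (t - 0)"
      using mvt_very_simple[of 0 t h "\<lambda>s x. h' s * x"] t by auto
    then show ?thesis
      using mult_nonpos_nonneg[of "h' s" t] h'_nonpos[of s] t by auto
  qed
  then show ?thesis by (simp add: h_def)
qed

theorem proposition2p5:
  fixes X :: "(real ^ 'm) set" and Y :: "(real ^ 'n) set"
    and f :: "(real ^ 'n) \<times> (real ^ 'm) \<Rightarrow> real"
    and grad_y :: "(real ^ 'n) \<times> (real ^ 'm) \<Rightarrow> real ^ 'n"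
    and grad_x :: "(real ^ 'n) \<times> (real ^ 'm) \<Rightarrow> real ^ 'm"
    and Q C :: "real ^ 'm \<Rightarrow> real"
    and xbar :: "real ^ 'm" and yhat ytilde :: "real ^ 'n"
    and \<epsilon>1 \<epsilon>2 l1 \<eta> lhat :: real
  assumes X: "X \<noteq> {}" "compact X" "convex X"
    and Y: "Y \<noteq> {}" "compact Y" "convex Y"
    and f_convex: "convex_on (Y \<times> X) f"
    and f_diff: "f differentiable_on (Y \<times> X)"
    and grad_y: "\<And>y x. y \<in> Y \<Longrightarrow> x \<in> X \<Longrightarrow>
      has_gradient_within (\<lambda>y'. f (y', x)) (grad_y (y, x)) y Y"
    and grad_x: "\<And>y x. y \<in> Y \<Longrightarrow> x \<in> X \<Longrightarrow>
      has_gradient_within (\<lambda>x'. f (y, x')) (grad_x (y, x)) x X"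
    and Q_eq: "Q = value_function f Y"
    and xbar: "xbar \<in> X"
    and eps: "\<epsilon>1 \<ge> 0" "\<epsilon>2 \<ge> 0"
    and yhat: "yhat \<in> Y" "Q xbar \<ge> f (yhat, xbar) - \<epsilon>1"
    and l1_eq: "l1 = (SUP y\<in>Y. grad_y (yhat, xbar) \<bullet> (yhat - y))"
    and ytilde: "ytilde \<in> Y" "l1 - \<epsilon>2 \<le> grad_y (yhat, xbar) \<bullet> (yhat - ytilde)"
    and \<eta>_eq: "\<eta> = \<epsilon>2 - (ytilde - yhat) \<bullet> grad_y (yhat, xbar)"
    and lhat_eq: "lhat = (yhat - ytilde) \<bullet> grad_y (yhat, xbar)"
    and C_eq: "C = (\<lambda>x. f (yhat, xbar) - \<eta> + grad_x (yhat, xbar) \<bullet> (x - xbar))"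
  shows "is_cut X Q C
    \<and> Q xbar - C xbar \<le> \<epsilon>2 + lhat
    \<and> (\<forall>M1>0.
          (\<forall>x\<in>X. \<forall>y1\<in>Y. \<forall>y2\<in>Y.
             norm (grad_y (y2, x) - grad_y (y1, x)) \<le> M1 * norm (y2 - y1))
          \<longrightarrow> Q xbar - C xbar \<le> cut_gap_bound \<epsilon>2 lhat M1 (diameter Y))"
proof -
  let ?gy = "grad_y (yhat, xbar)" and ?gx = "grad_x (yhat, xbar)"
  obtain D where D: "(f has_derivative D) (at (yhat, xbar) within Y \<times> X)"
    using f_diff yhat(1) xbar by (auto simp: differentiable_on_def differentiable_def)
  have tangent: "f (yhat, xbar) + ?gy \<bullet> (y - yhat) + ?gx \<bullet> (x - xbar) \<le> f (y, x)"
    if "y \<in> Y" "x \<in> X" for x y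
    using convex_on_imp_above_tangent_within[OF f_convex _ _ D, of "(y, x)"]
      derivative_eq_sum_of_partial_gradients[OF Y(3) yhat(1) that(1) X(3) xbar that(2) D
        grad_y[OF yhat(1) xbar] grad_x[OF yhat(1) xbar]] yhat(1) xbar that
    by simp
  have \<eta>: "\<eta> = \<epsilon>2 + lhat"
    by (simp add: \<eta>_eq lhat_eq inner_diff)

  have "compact ((\<lambda>y. ?gy \<bullet> (yhat - y)) ` Y)"
    by (intro compact_continuous_image continuous_intros Y)
  then have "bdd_above ((\<lambda>y. ?gy \<bullet> (yhat - y)) ` Y)"
    by (intro bounded_imp_bdd_above compact_imp_bounded)
  then have "?gy \<bullet> (yhat - y) \<le> l1" if "y \<in> Y" for y
    unfolding l1_eq using that by (rule cSUP_upper2) auto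
  then have gap: "?gy \<bullet> (yhat - y) \<le> \<eta>" if "y \<in> Y" for y
    using that ytilde(2) by (force simp: \<eta> lhat_eq inner_commute)
  have below: "C x \<le> f (y, x)" if "y \<in> Y" "x \<in> X" for x y
    using tangent[OF that] gap[OF that(1)] by (simp add: C_eq inner_diff)

  have "C x \<le> Q x" if "x \<in> X" for x
    unfolding Q_eq value_function_def using Y(1) below that by (intro cINF_greatest) auto
  moreover have "\<exists>L b. linear L \<and> (\<forall>x. C x = L x + b)"
  proof (intro exI conjI allI)
    show "linear (\<lambda>x. ?gx \<bullet> x)"
      by (intro bounded_linear.linear bounded_linear_inner_right)
    show "C x = ?gx \<bullet> x + (f (yhat, xbar) - \<eta> - ?gx \<bullet> xbar)" for x
      by (simp add: C_eq inner_diff)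
  qed
  ultimately have cut: "is_cut X Q C" by (simp add: is_cut_def)

  have Q_le: "Q xbar \<le> f (y, xbar)" if "y \<in> Y" for y
  proof -
    have "bdd_below ((\<lambda>y. f (y, xbar)) ` Y)"
      using below xbar by (auto intro!: bdd_belowI[of _ "C xbar"])
    then show ?thesis
      unfolding Q_eq value_function_def using that by (rule cINF_lower)
  qed
  have C_xbar: "C xbar = f (yhat, xbar) - (\<epsilon>2 + lhat)"
    by (simp add: C_eq \<eta>)
  have dist: "Q xbar - C xbar \<le> \<epsilon>2 + lhat"
    using Q_le[OF yhat(1)] C_xbar by simp

  have "Q xbar - C xbar \<le> cut_gap_bound \<epsilon>2 lhat M (diameter Y)"
    if M: "M > 0" and lip: "\<forall>x\<in>X. \<forall>y1\<in>Y. \<forall>y2\<in>Y.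
      norm (grad_y (y2, x) - grad_y (y1, x)) \<le> M * norm (y2 - y1)" for M
  proof -
    let ?d = "diameter Y"
    have parabola: "Q xbar - C xbar \<le> \<epsilon>2 + lhat - t * lhat + M / 2 * t\<^sup>2 * ?d\<^sup>2"
      if t: "t \<in> {0..1}" for t
    proof -
      have "yhat + t *\<^sub>R (ytilde - yhat) \<in> Y"
        using Y(3) yhat(1) ytilde(1) t by (auto simp: algebra_simps convex_alt)
      then have "Q xbar \<le> f (yhat + t *\<^sub>R (ytilde - yhat), xbar)" by (rule Q_le)
      also have "\<dots> \<le> f (yhat, xbar) + t * (?gy \<bullet> (ytilde - yhat))
          + M / 2 * (t * norm (ytilde - yhat))\<^sup>2"
        using lipschitz_gradient_descent[OF Y(3) yhat(1) ytilde(1),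
            of "\<lambda>y. f (y, xbar)" "\<lambda>y. grad_y (y, xbar)" M t] grad_y lip yhat(1) xbar t
        by blast
      also have "?gy \<bullet> (ytilde - yhat) = - lhat"
        by (simp add: lhat_eq inner_diff inner_commute)
      also have "M / 2 * (t * norm (ytilde - yhat))\<^sup>2 \<le> M / 2 * (t * ?d)\<^sup>2"
      proof -
        have "norm (ytilde - yhat) \<le> ?d"
          using diameter_bounded_bound[OF compact_imp_bounded[OF Y(2)] ytilde(1) yhat(1)]
          by (simp add: dist_norm)
        then show ?thesis
          using M t by (intro mult_left_mono power_mono) auto
      qed
      finally show ?thesis
        using C_xbar by (simp add: power_mult_distrib)
    qed
    consider "lhat \<le> 0" | "0 < lhat" "lhat \<le> M * ?d\<^sup>2" | "0 < lhat" "lhat > M * ?d\<^sup>2"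
      by linarith
    then show ?thesis
    proof cases
      case 1
      then show ?thesis using dist by (simp add: cut_gap_bound_def)
    next
      case 2
      then have pos: "M * ?d\<^sup>2 > 0" by linarith
      \<comment> \<open>The vertex of the parabola.\<close>
      define t where "t = lhat / (M * ?d\<^sup>2)"
      have "t \<in> {0..1}" using 2 pos by (simp add: t_def)
      note parabola[OF this]
      also have "\<epsilon>2 + lhat - t * lhat + M / 2 * t\<^sup>2 * ?d\<^sup>2
          = \<epsilon>2 + lhat / (2 * M * ?d\<^sup>2) * (2 * M * ?d\<^sup>2 - lhat)"
        using pos M by (cases "?d = 0") (simp_all add: t_def field_simps power2_eq_square)
      finally show ?thesis using 2 by (simp add: cut_gap_bound_def)
    next
      case 3
      \<comment> \<open>The vertex lies beyond \<open>1\<close>, so the parabola is smallest at \<open>1\<close>; there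
        \<open>M / 2 * ?d\<^sup>2 < lhat / 2\<close>.\<close>
      have "Q xbar - C xbar \<le> \<epsilon>2 + M / 2 * ?d\<^sup>2"
        using parabola[of 1] by simp
      then show ?thesis using 3 by (simp add: cut_gap_bound_def)
    qed
  qed
  with cut dist show ?thesis by blast
qed

end
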